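(* Assume that $(U,\tau)$ is a conventional simple fiducial model for the statistical model $\{P_T^\theta \mid \theta\in\Omega_\Theta\}$. If the (possibly improper) Bayesian prior $P_\Theta$ implies that the distribution of $\tau(u,\Theta)$, i.e. the measure $A\mapsto P_\Theta(\{\theta : \tau(u,\theta)\in A\})$ on $\Omega_T$, does not depend on $u$, then the Bayesian posterior distribution $P_\Theta^t$ of $\Theta$ given $T=t$, where $T=\tau(U,\Theta)$, is well defined (in particular, the $\sigma$-finiteness of $T$ is part of the conclusion) and is identical with the fiducial distribution of $\Theta^t$, i.e. the distribution of $\Theta^t=\theta^t(U)$ with $U\sim P_U^\theta$.
   Context: Basic space: all random elements are defined on a common underlying $\sigma$-finite measure space $(\Omega,\mathcal{E},P)$; $P(\Omega)=1$ is not required, and $P(\Omega)=\infty$ is allowed. A random element $Z$ in a measurable space $(\Omega_Z,\mathcal{E}_Z)$ is a measurable function $Z:\Omega\to\Omega_Z$. Its law (distribution) is $P_Z(A)=P(Z\in A)$, and $Z$ is called $\sigma$-finite if $P_Z$ is a $\sigma$-finite measure. We write $Z\sim m$ if the law of $Z$ is $m$. Conditional laws: if $X,Y$ are random elements and $Y$ is $\sigma$-finite, the conditional law $P_X^y=P_X(\cdot\mid Y=y)$ is defined, via the Radon-Nikodym theorem exactly as for probability spaces, by the factorization $P_{X,Y}(dx,dy)=P_X^y(dx)\,P_Y(dy)$. As usual, conditional laws are determined only up to $P_Y$-null sets of $y$, and they are treated as families of probability measures (regular conditional laws), which exist given appropriate regularity conditions. Statistical and Bayesian models: a statistical model is a family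 $\{P_T^\theta\mid\theta\in\Omega_\Theta\}$ of probability measures on the sample space $\Omega_T$ such that there exist a random element $T$ in $\Omega_T$ and a $\sigma$-finite random element $\Theta$ in the model parameter space $\Omega_\Theta$ with $P_T^\theta(A)=P(T\in A\mid\Theta=\theta)$; here $\Omega_T$ and $\Omega_\Theta$ are measurable spaces. A Bayesian model is a statistical model together with a specification of the $\sigma$-finite law $P_\Theta$ of $\Theta$ (the prior, possibly improper, i.e. of infinite total mass). The posterior $P_\Theta^t$ is the conditional law of $\Theta$ given $T=t$; it is well defined if $T$ is $\sigma$-finite. Fiducial model: let $\Theta$ be a $\sigma$-finite random element in $\Omega_\Theta$. A fiducial model $(U,\tau)$ consists of a random element $U$ in a measurable space $\Omega_U$ (the Monte Carlo space) and a measurable function $\tau:\Omega_U\times\Omega_\Theta\to\Omega_T$. It is a fiducial model for the statistical model $\{P_T^\theta\}$ if the conditional law of $\tau(U,\Theta)$ given $\Theta=\theta$ is $P_T^\theta$. It is conventional if the conditional law $P_U^\theta$ of $U$ given $\Theta=\theta$ does not depend on $\theta$. It is simple if the fiducial equation $\tau(u,\theta)=t$ has a unique solution $\theta=\theta^t(u)$ for all $u,t$. If the model is both conventional and simple, the fiducial distribution corresponding to an observation $t\in\Omega_T$ is the distribution of $\Theta^t=\theta^t(U)$, where $U\sim P_U^\theta$.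
   Formalization: The solution map (u,t) ↦ θ^t(u) is additionally assumed jointly measurable (automatic on standard Borel spaces); without it the claim fails, e.g. Lebesgue prior on ℝ, τ(u,θ)=θ, trivial sigma-algebra on Ω_T, where T is not sigma-finite. *)

theory Defs
  imports "HOL-Probability.Probability"
begin

text \<open>
  All random elements are measurable functions on one underlying measure space \<open>M\<close>, which is
  only required to be sigma-finite; the law of \<open>Z\<close> is \<^term>\<open>distr M N Z\<close>.
\<close>

definition sigma_finite_element :: "'w measure \<Rightarrow> 'y measure \<Rightarrow> ('w \<Rightarrow> 'y) \<Rightarrow> bool" where
  "sigma_finite_element M N Y \<longleftrightarrow> Y \<in> M \<rightarrow>\<^sub>M N \<and> sigma_finite_measure (distr M N Y)"

text \<open>
  \<open>K\<close> is (a version of) the regular conditional law of \<open>X\<close> given \<open>Y\<close>: a probability kernel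
  satisfying the factorization \<open>P_{X,Y}(dx,dy) = K y (dx) P_Y(dy)\<close>.  The conditional law is only
  determined up to \<open>P_Y\<close>-null sets, so this is a predicate on kernels, not a function.
  The type \<^const>\<open>prob_algebra\<close> of the kernel includes that every \<open>K y\<close> with
  \<open>y \<in> space NY\<close> is a probability measure on \<open>NX\<close>.
\<close>

definition conditional_law ::
  "'w measure \<Rightarrow> 'x measure \<Rightarrow> ('w \<Rightarrow> 'x) \<Rightarrow> 'y measure \<Rightarrow> ('w \<Rightarrow> 'y) \<Rightarrow> ('y \<Rightarrow> 'x measure) \<Rightarrow> bool"
where
  "conditional_law M NX X NY Y K \<longleftrightarrow>
     X \<in> M \<rightarrow>\<^sub>M NX \<and> sigma_finite_element M NY Y \<and> K \<in> NY \<rightarrow>\<^sub>M prob_algebra NX \<and>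
     (\<forall>C \<in> sets (NX \<Otimes>\<^sub>M NY).
        emeasure (distr M (NX \<Otimes>\<^sub>M NY) (\<lambda>\<omega>. (X \<omega>, Y \<omega>))) C =
          (\<integral>\<^sup>+ y. (\<integral>\<^sup>+ x. indicator C (x, y) \<partial>K y) \<partial>distr M NY Y))"

definition statistical_model ::
  "'w measure \<Rightarrow> 'p measure \<Rightarrow> 't measure \<Rightarrow> ('p \<Rightarrow> 't measure) \<Rightarrow> bool" where
  "statistical_model M M\<Theta> MT PT \<longleftrightarrow> (\<exists>T \<Theta>. conditional_law M MT T M\<Theta> \<Theta> PT)"

definition fiducial_model ::
  "'w measure \<Rightarrow> 'p measure \<Rightarrow> ('w \<Rightarrow> 'p) \<Rightarrow> 't measure \<Rightarrow>
   'u measure \<Rightarrow> ('w \<Rightarrow> 'u) \<Rightarrow> ('u \<times> 'p \<Rightarrow> 't) \<Rightarrow> bool" where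
  "fiducial_model M M\<Theta> \<Theta> MT MU U \<tau> \<longleftrightarrow>
     sigma_finite_element M M\<Theta> \<Theta> \<and> U \<in> M \<rightarrow>\<^sub>M MU \<and> \<tau> \<in> MU \<Otimes>\<^sub>M M\<Theta> \<rightarrow>\<^sub>M MT"

definition fiducial_model_for ::
  "'w measure \<Rightarrow> 'p measure \<Rightarrow> ('w \<Rightarrow> 'p) \<Rightarrow> 't measure \<Rightarrow>
   'u measure \<Rightarrow> ('w \<Rightarrow> 'u) \<Rightarrow> ('u \<times> 'p \<Rightarrow> 't) \<Rightarrow> ('p \<Rightarrow> 't measure) \<Rightarrow> bool" where
  "fiducial_model_for M M\<Theta> \<Theta> MT MU U \<tau> PT \<longleftrightarrow>
     fiducial_model M M\<Theta> \<Theta> MT MU U \<tau> \<and> statistical_model M M\<Theta> MT PT \<and>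
     conditional_law M MT (\<lambda>\<omega>. \<tau> (U \<omega>, \<Theta> \<omega>)) M\<Theta> \<Theta> PT"

text \<open>
  \<open>PU\<close> is a version of the conditional law of \<open>U\<close> given \<open>\<Theta> = \<theta>\<close> that does not depend on \<open>\<theta>\<close>.
\<close>

definition conventional ::
  "'w measure \<Rightarrow> 'p measure \<Rightarrow> ('w \<Rightarrow> 'p) \<Rightarrow> 'u measure \<Rightarrow> ('w \<Rightarrow> 'u) \<Rightarrow> ('p \<Rightarrow> 'u measure) \<Rightarrow> bool"
where
  "conventional M M\<Theta> \<Theta> MU U PU \<longleftrightarrow>
     conditional_law M MU U M\<Theta> \<Theta> PU \<and> (\<forall>\<theta>\<in>space M\<Theta>. \<forall>\<theta>'\<in>space M\<Theta>. PU \<theta> = PU \<theta>')"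

definition simple_model ::
  "'p measure \<Rightarrow> 't measure \<Rightarrow> 'u measure \<Rightarrow> ('u \<times> 'p \<Rightarrow> 't) \<Rightarrow> bool" where
  "simple_model M\<Theta> MT MU \<tau> \<longleftrightarrow>
     (\<forall>u\<in>space MU. \<forall>t\<in>space MT. \<exists>!\<theta>. \<theta> \<in> space M\<Theta> \<and> \<tau> (u, \<theta>) = t)"

definition fiducial_solution ::
  "'p measure \<Rightarrow> ('u \<times> 'p \<Rightarrow> 't) \<Rightarrow> 't \<Rightarrow> 'u \<Rightarrow> 'p" where
  "fiducial_solution M\<Theta> \<tau> t u = (THE \<theta>. \<theta> \<in> space M\<Theta> \<and> \<tau> (u, \<theta>) = t)"

text \<open>
  The law of \<open>\<theta>\<^sup>t(U)\<close> for \<open>U \<sim> Q\<close>.  The value of \<^const>\<open>distr\<close> is meaningful only if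
  \<open>\<theta>\<^sup>t\<close> is measurable.
\<close>

definition fiducial_distribution ::
  "'p measure \<Rightarrow> ('u \<times> 'p \<Rightarrow> 't) \<Rightarrow> 'u measure \<Rightarrow> 't \<Rightarrow> 'p measure" where
  "fiducial_distribution M\<Theta> \<tau> Q t = distr Q M\<Theta> (fiducial_solution M\<Theta> \<tau> t)"

end

theory Submission
  imports Defs
begin

text \<open>
  Since \<open>U\<close> has the same conditional law \<open>Q\<close> for all parameters, the joint law of \<open>(U, \<Theta>)\<close> is
  the product of \<open>Q\<close> and the prior.  The substitution \<open>t = \<tau>(u, \<theta>)\<close>, carried out for fixed \<open>u\<close>,
  maps the prior to a measure \<open>\<nu>\<close> that does not depend on \<open>u\<close>, so the joint law of \<open>(U, T)\<close> is the
  product of \<open>Q\<close> and \<open>\<nu>\<close>, and \<open>\<Theta> = \<theta>\<^sup>T(U)\<close>.  For fixed \<open>u\<close> the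
  substitution is a measurable isomorphism, which makes \<open>\<nu>\<close>, the law of \<open>T\<close>, sigma-finite.
\<close>

text \<open>An image of a sigma-finite measure need not be sigma-finite: projecting planar Lebesgue
  measure to a line gives only the values 0 and infinity. With a measurable left inverse
  \<open>g\<close>, the image is carried back to \<open>M\<close>, and preimages under
  \<open>g\<close> of a countable cover by sets of finite measure form such a cover again.\<close>

lemma sigma_finite_measure_distr_left_inverse:
  assumes "sigma_finite_measure M" and f: "f \<in> M \<rightarrow>\<^sub>M N" and g: "g \<in> N \<rightarrow>\<^sub>M M"
    and gf: "\<And>x. x \<in> space M \<Longrightarrow> g (f x) = x"
  shows "sigma_finite_measure (distr M N f)"
proof (rule sigma_finite_measure_distr)
  have "distr (distr M N f) M g = distr M M (\<lambda>x. x)"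
    using f g gf by (simp add: distr_distr cong: distr_cong)
  then show "sigma_finite_measure (distr (distr M N f) M g)"
    using assms(1) by (simp add: distr_id2)
  show "g \<in> distr M N f \<rightarrow>\<^sub>M M"
    using g by simp
qed

text \<open>Supplies the kernel clause of \<open>conditional_law\<close> when the candidate law is
  the image of one fixed probability measure under maps depending on \<open>y\<close>. Joint
  measurability of these maps is what makes the images vary measurably.\<close>

lemma measurable_distr_param_prob_algebra:
  assumes Q: "prob_space Q" and f: "(\<lambda>(x, y). f y x) \<in> Q \<Otimes>\<^sub>M N \<rightarrow>\<^sub>M L"
  shows "(\<lambda>y. distr Q L (f y)) \<in> N \<rightarrow>\<^sub>M prob_algebra L"
proof (rule measurable_distr_prob_space2)
  show "(\<lambda>y. Q) \<in> N \<rightarrow>\<^sub>M prob_algebra Q"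
    using Q by (intro measurable_const) (simp add: space_prob_algebra)
  show "case_prod f \<in> N \<Otimes>\<^sub>M Q \<rightarrow>\<^sub>M L"
    using measurable_compose[OF measurable_pair_swap' f] by (simp add: case_prod_unfold)
qed

text \<open>On a rectangle the inner integral of the factorization collapses to
  \<open>emeasure (K y) A * indicator B y\<close>. The right-hand side no longer mentions
  \<open>K\<close>, so any two versions produce the same measure; uniqueness rests on this.\<close>

lemma conditional_law_emeasure:
  assumes K: "conditional_law M NX X NY Y K" and A: "A \<in> sets NX" and B: "B \<in> sets NY"
  shows "emeasure (density (distr M NY Y) (\<lambda>y. emeasure (K y) A)) B =
    emeasure (distr M (NX \<Otimes>\<^sub>M NY) (\<lambda>\<omega>. (X \<omega>, Y \<omega>))) (A \<times> B)"
proof -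
  have KA: "K \<in> NY \<rightarrow>\<^sub>M subprob_algebra NX"
    using K by (auto simp: conditional_law_def intro: measurable_prob_algebraD)
  have sets_K: "sets (K y) = sets NX" if "y \<in> space NY" for y
    using KA that by (rule sets_kernel)
  have [measurable]: "(\<lambda>y. emeasure (K y) A) \<in> borel_measurable NY"
    using KA A by (rule measurable_emeasure_kernel)
  have "emeasure (distr M (NX \<Otimes>\<^sub>M NY) (\<lambda>\<omega>. (X \<omega>, Y \<omega>))) (A \<times> B) =
      (\<integral>\<^sup>+ y. (\<integral>\<^sup>+ x. indicator (A \<times> B) (x, y) \<partial>K y) \<partial>distr M NY Y)"
    using K A B by (auto simp: conditional_law_def)
  also have "\<dots> = (\<integral>\<^sup>+ y. emeasure (K y) A * indicator B y \<partial>distr M NY Y)"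
    by (rule nn_integral_cong) (simp add: sets_K A indicator_times nn_integral_multc borel_measurable_indicator)
  also have "\<dots> = emeasure (density (distr M NY Y) (\<lambda>y. emeasure (K y) A)) B"
    using B by (simp add: emeasure_density)
  finally show ?thesis ..
qed

text \<open>This is the uniqueness half of Radon-Nikodym: two densities of the same measure with
  respect to a sigma-finite measure agree almost everywhere. The exceptional null set may depend on
  \<open>A\<close>.\<close>

lemma conditional_law_AE_unique:
  assumes K: "conditional_law M NX X NY Y K" and L: "conditional_law M NX X NY Y L"
    and A: "A \<in> sets NX"
  shows "AE y in distr M NY Y. emeasure (K y) A = emeasure (L y) A"
proof -
  interpret sigma_finite_measure "distr M NY Y"
    using K by (simp add: conditional_law_def sigma_finite_element_def)
  have meas: "(\<lambda>y. emeasure (J y) A) \<in> borel_measurable (distr M NY Y)"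
    if "conditional_law M NX X NY Y J" for J
    using that measurable_emeasure_kernel[OF measurable_prob_algebraD A, of J NY]
    by (simp add: conditional_law_def)
  have "density (distr M NY Y) (\<lambda>y. emeasure (K y) A) =
      density (distr M NY Y) (\<lambda>y. emeasure (L y) A)"
    by (rule measure_eqI) (auto simp: conditional_law_emeasure[OF K A] conditional_law_emeasure[OF L A])
  then show ?thesis
    using meas[OF K] meas[OF L] by (simp add: density_unique_iff)
qed

text \<open>With a constant kernel the factorization is an iterated integral over two fixed
  sigma-finite measures, which Tonelli identifies with the product measure.\<close>

lemma conditional_law_const_pair:
  assumes Q: "prob_space Q" "sets Q = sets NX"
    and law: "conditional_law M NX X NY Y K" and K: "\<And>y. y \<in> space NY \<Longrightarrow> K y = Q"
  shows "distr M (NX \<Otimes>\<^sub>M NY) (\<lambda>\<omega>. (X \<omega>, Y \<omega>)) = Q \<Otimes>\<^sub>M distr M NY Y"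
proof (rule measure_eqI)
  interpret Q: prob_space Q by (rule Q)
  interpret Y: sigma_finite_measure "distr M NY Y"
    using law by (simp add: conditional_law_def sigma_finite_element_def)
  interpret pair_sigma_finite Q "distr M NY Y" ..
  show sets_eq: "sets (distr M (NX \<Otimes>\<^sub>M NY) (\<lambda>\<omega>. (X \<omega>, Y \<omega>))) = sets (Q \<Otimes>\<^sub>M distr M NY Y)"
    using Q(2) by (simp cong: sets_pair_measure_cong)
  fix C assume C: "C \<in> sets (distr M (NX \<Otimes>\<^sub>M NY) (\<lambda>\<omega>. (X \<omega>, Y \<omega>)))"
  then have "emeasure (distr M (NX \<Otimes>\<^sub>M NY) (\<lambda>\<omega>. (X \<omega>, Y \<omega>))) C =
      (\<integral>\<^sup>+ y. (\<integral>\<^sup>+ x. indicator C (x, y) \<partial>K y) \<partial>distr M NY Y)"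
    using law by (simp add: conditional_law_def)
  also have "\<dots> = (\<integral>\<^sup>+ y. (\<integral>\<^sup>+ x. indicator C (x, y) \<partial>Q) \<partial>distr M NY Y)"
    by (rule nn_integral_cong) (simp add: K)
  also have "\<dots> = emeasure (Q \<Otimes>\<^sub>M distr M NY Y) C"
    using C sets_eq by (subst nn_integral_snd) auto
  finally show "emeasure (distr M (NX \<Otimes>\<^sub>M NY) (\<lambda>\<omega>. (X \<omega>, Y \<omega>))) C =
      emeasure (Q \<Otimes>\<^sub>M distr M NY Y) C" .
qed

text \<open>A change of variables in the second coordinate only. Tonelli reduces it to a fixed
  \<open>u\<close>, where the image of \<open>P\<close> is \<open>N\<close> by assumption; a second
  use of Tonelli reassembles the product.\<close>

lemma distr_pair_fibrewise:
  assumes Q: "prob_space Q" and P: "sigma_finite_measure P" and N: "sigma_finite_measure N"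
    and f: "f \<in> Q \<Otimes>\<^sub>M P \<rightarrow>\<^sub>M N"
    and fibre: "\<And>u. u \<in> space Q \<Longrightarrow> distr P N (\<lambda>x. f (u, x)) = N"
  shows "distr (Q \<Otimes>\<^sub>M P) (Q \<Otimes>\<^sub>M N) (\<lambda>(u, x). (u, f (u, x))) = Q \<Otimes>\<^sub>M N"
proof (rule measure_eqI)
  interpret Q: prob_space Q by (rule Q)
  interpret P: sigma_finite_measure P by (rule P)
  interpret N: sigma_finite_measure N by (rule N)
  note [measurable] = f
  fix C assume "C \<in> sets (distr (Q \<Otimes>\<^sub>M P) (Q \<Otimes>\<^sub>M N) (\<lambda>(u, x). (u, f (u, x))))"
  then have [measurable]: "C \<in> sets (Q \<Otimes>\<^sub>M N)"
    by simp
  have "emeasure (distr (Q \<Otimes>\<^sub>M P) (Q \<Otimes>\<^sub>M N) (\<lambda>(u, x). (u, f (u, x)))) C =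
      (\<integral>\<^sup>+ z. indicator C z \<partial>distr (Q \<Otimes>\<^sub>M P) (Q \<Otimes>\<^sub>M N) (\<lambda>(u, x). (u, f (u, x))))"
    by simp
  also have "\<dots> = (\<integral>\<^sup>+ z. indicator C (fst z, f z) \<partial>(Q \<Otimes>\<^sub>M P))"
    by (subst nn_integral_distr) (auto simp: case_prod_unfold)
  also have "\<dots> = (\<integral>\<^sup>+ u. (\<integral>\<^sup>+ x. indicator C (u, f (u, x)) \<partial>P) \<partial>Q)"
    by (subst P.nn_integral_fst[symmetric]) auto
  also have "\<dots> = (\<integral>\<^sup>+ u. (\<integral>\<^sup>+ t. indicator C (u, t) \<partial>N) \<partial>Q)"
  proof (rule nn_integral_cong)
    fix u assume u [measurable]: "u \<in> space Q"
    have "(\<integral>\<^sup>+ x. indicator C (u, f (u, x)) \<partial>P) =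
        (\<integral>\<^sup>+ t. indicator C (u, t) \<partial>distr P N (\<lambda>x. f (u, x)))"
      by (subst nn_integral_distr) auto
    then show "(\<integral>\<^sup>+ x. indicator C (u, f (u, x)) \<partial>P) = (\<integral>\<^sup>+ t. indicator C (u, t) \<partial>N)"
      by (simp add: fibre[OF u])
  qed
  also have "\<dots> = emeasure (Q \<Otimes>\<^sub>M N) C"
    by (subst N.nn_integral_fst) auto
  finally show "emeasure (distr (Q \<Otimes>\<^sub>M P) (Q \<Otimes>\<^sub>M N) (\<lambda>(u, x). (u, f (u, x)))) C =
      emeasure (Q \<Otimes>\<^sub>M N) C" .
qed simp

text \<open>The freezing principle: if the joint law of \<open>U\<close> and \<open>Y\<close> is a
  product with \<open>Q\<close>, conditioning on \<open>Y = y\<close> leaves \<open>U\<close> with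
  law \<open>Q\<close>, so \<open>X\<close> gets the law of \<open>s y\<close> under
  \<open>Q\<close>. The law of \<open>Y\<close> may have infinite mass.\<close>

lemma conditional_law_of_independent:
  assumes Q: "prob_space Q" and Y: "sigma_finite_element M NY Y"
    and U: "U \<in> M \<rightarrow>\<^sub>M Q"
    and joint: "distr M (Q \<Otimes>\<^sub>M NY) (\<lambda>\<omega>. (U \<omega>, Y \<omega>)) = Q \<Otimes>\<^sub>M distr M NY Y"
    and s: "(\<lambda>(u, y). s y u) \<in> Q \<Otimes>\<^sub>M NY \<rightarrow>\<^sub>M NX"
    and X: "\<And>\<omega>. \<omega> \<in> space M \<Longrightarrow> X \<omega> = s (Y \<omega>) (U \<omega>)"
  shows "conditional_law M NX X NY Y (\<lambda>y. distr Q NX (s y))"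
proof -
  interpret Q: prob_space Q by (rule Q)
  interpret Y: sigma_finite_measure "distr M NY Y"
    using Y by (simp add: sigma_finite_element_def)
  interpret pair_sigma_finite Q "distr M NY Y" ..
  note [measurable] = U
  have [measurable]: "Y \<in> M \<rightarrow>\<^sub>M NY"
    using Y by (simp add: sigma_finite_element_def)
  have s' [measurable]: "(\<lambda>z. s (snd z) (fst z)) \<in> Q \<Otimes>\<^sub>M NY \<rightarrow>\<^sub>M NX"
    using s by (simp add: case_prod_unfold)
  have s_comp: "(\<lambda>\<omega>. s (Y \<omega>) (U \<omega>)) \<in> M \<rightarrow>\<^sub>M NX"
    using measurable_compose[OF _ s', of "\<lambda>\<omega>. (U \<omega>, Y \<omega>)" M] by simp
  then have X_meas [measurable]: "X \<in> M \<rightarrow>\<^sub>M NX"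
    using X by (simp cong: measurable_cong)
  have s_y: "s y \<in> Q \<rightarrow>\<^sub>M NX" if "y \<in> space NY" for y
    using measurable_compose[OF measurable_Pair2'[OF that] s'] by simp
  have "emeasure (distr M (NX \<Otimes>\<^sub>M NY) (\<lambda>\<omega>. (X \<omega>, Y \<omega>))) C =
      (\<integral>\<^sup>+ y. (\<integral>\<^sup>+ x. indicator C (x, y) \<partial>distr Q NX (s y)) \<partial>distr M NY Y)"
    if C [measurable]: "C \<in> sets (NX \<Otimes>\<^sub>M NY)" for C
  proof -
    have "emeasure (distr M (NX \<Otimes>\<^sub>M NY) (\<lambda>\<omega>. (X \<omega>, Y \<omega>))) C =
        (\<integral>\<^sup>+ z. indicator C z \<partial>distr M (NX \<Otimes>\<^sub>M NY) (\<lambda>\<omega>. (X \<omega>, Y \<omega>)))"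
      by simp
    also have "\<dots> = (\<integral>\<^sup>+ \<omega>. indicator C (X \<omega>, Y \<omega>) \<partial>M)"
      by (rule nn_integral_distr) auto
    also have "\<dots> = (\<integral>\<^sup>+ \<omega>. indicator C (s (Y \<omega>) (U \<omega>), Y \<omega>) \<partial>M)"
      by (rule nn_integral_cong) (simp add: X)
    also have "\<dots> = (\<integral>\<^sup>+ z. indicator C (s (snd z) (fst z), snd z)
        \<partial>distr M (Q \<Otimes>\<^sub>M NY) (\<lambda>\<omega>. (U \<omega>, Y \<omega>)))"
      by (subst nn_integral_distr) auto
    also have "\<dots> = (\<integral>\<^sup>+ y. (\<integral>\<^sup>+ u. indicator C (s y u, y) \<partial>Q) \<partial>distr M NY Y)"
      unfolding joint by (subst nn_integral_snd[symmetric]) auto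
    also have "\<dots> = (\<integral>\<^sup>+ y. (\<integral>\<^sup>+ x. indicator C (x, y) \<partial>distr Q NX (s y)) \<partial>distr M NY Y)"
    proof (rule nn_integral_cong)
      fix y assume "y \<in> space (distr M NY Y)"
      then have [measurable]: "y \<in> space NY"
        by simp
      note [measurable] = s_y[OF this]
      show "(\<integral>\<^sup>+ u. indicator C (s y u, y) \<partial>Q) = (\<integral>\<^sup>+ x. indicator C (x, y) \<partial>distr Q NX (s y))"
        by (subst nn_integral_distr) auto
    qed
    finally show ?thesis .
  qed
  then show ?thesis
    using X_meas Y measurable_distr_param_prob_algebra[OF Q s] by (simp add: conditional_law_def)
qed

lemma simple_model_fiducial_solution:
  assumes "simple_model M\<Theta> MT MU \<tau>" and "u \<in> space MU" and "\<theta> \<in> space M\<Theta>"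
    and "\<tau> (u, \<theta>) \<in> space MT"
  shows "fiducial_solution M\<Theta> \<tau> (\<tau> (u, \<theta>)) u = \<theta>"
  using assms unfolding simple_model_def fiducial_solution_def
  by (intro the1_equality) auto

theorem theorem1:
  fixes M :: "'w measure" and M\<Theta> :: "'p measure" and MT :: "'t measure" and MU :: "'u measure"
    and \<Theta> :: "'w \<Rightarrow> 'p" and U :: "'w \<Rightarrow> 'u" and T :: "'w \<Rightarrow> 't" and \<tau> :: "'u \<times> 'p \<Rightarrow> 't"
    and PT :: "'p \<Rightarrow> 't measure" and PU :: "'p \<Rightarrow> 'u measure"
  assumes base: "sigma_finite_measure M"
    and model: "fiducial_model_for M M\<Theta> \<Theta> MT MU U \<tau> PT"
    and conv: "conventional M M\<Theta> \<Theta> MU U PU"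
    and simple: "simple_model M\<Theta> MT MU \<tau>"
    and solution_measurable:
      "(\<lambda>(u, t). fiducial_solution M\<Theta> \<tau> t u) \<in> MU \<Otimes>\<^sub>M MT \<rightarrow>\<^sub>M M\<Theta>"
    and T_def: "T = (\<lambda>\<omega>. \<tau> (U \<omega>, \<Theta> \<omega>))"
    and prior: "\<And>u u'. u \<in> space MU \<Longrightarrow> u' \<in> space MU \<Longrightarrow>
      distr (distr M M\<Theta> \<Theta>) MT (\<lambda>\<theta>. \<tau> (u, \<theta>)) = distr (distr M M\<Theta> \<Theta>) MT (\<lambda>\<theta>. \<tau> (u', \<theta>))"
  shows "sigma_finite_element M MT T \<and>
    (\<forall>\<theta>\<in>space M\<Theta>.
      conditional_law M M\<Theta> \<Theta> MT T (fiducial_distribution M\<Theta> \<tau> (PU \<theta>)) \<and>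
      (\<forall>K. conditional_law M M\<Theta> \<Theta> MT T K \<longrightarrow>
        (\<forall>A\<in>sets M\<Theta>. AE t in distr M MT T.
          emeasure (K t) A = emeasure (fiducial_distribution M\<Theta> \<tau> (PU \<theta>) t) A)))"
proof -
  have \<Theta>: "sigma_finite_element M M\<Theta> \<Theta>" and U [measurable]: "U \<in> M \<rightarrow>\<^sub>M MU"
    and \<tau> [measurable]: "\<tau> \<in> MU \<Otimes>\<^sub>M M\<Theta> \<rightarrow>\<^sub>M MT"
    using model by (auto simp: fiducial_model_for_def fiducial_model_def)
  have \<Theta>_meas [measurable]: "\<Theta> \<in> M \<rightarrow>\<^sub>M M\<Theta>"
    using \<Theta> by (simp add: sigma_finite_element_def)
  have T_meas: "T \<in> M \<rightarrow>\<^sub>M MT"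
    unfolding T_def by measurable
  have law_U: "conditional_law M MU U M\<Theta> \<Theta> PU"
    and PU_const: "\<And>\<theta> \<theta>'. \<theta> \<in> space M\<Theta> \<Longrightarrow> \<theta>' \<in> space M\<Theta> \<Longrightarrow> PU \<theta> = PU \<theta>'"
    using conv unfolding conventional_def by blast+
  \<comment> \<open>A parameter \<open>\<theta>\<close> is fixed only to pick the common value of
    \<open>PU\<close>. Sigma-finiteness of \<open>T\<close> does not mention
    \<open>\<theta>\<close>, but is proved here under the assumption that one exists.\<close>
  have main: "sigma_finite_element M MT T \<and>
      conditional_law M M\<Theta> \<Theta> MT T (fiducial_distribution M\<Theta> \<tau> (PU \<theta>))"
    if \<theta>: "\<theta> \<in> space M\<Theta>" for \<theta>
  proof -
    define P where "P = distr M M\<Theta> \<Theta>"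
    define Q where "Q = PU \<theta>"
    have sets_P [measurable_cong]: "sets P = sets M\<Theta>" and space_P: "space P = space M\<Theta>"
      by (auto simp: P_def)
    have "Q \<in> space (prob_algebra MU)"
      using law_U \<theta> by (auto simp: Q_def conditional_law_def dest: measurable_space)
    then have Q: "prob_space Q" and sets_Q [measurable_cong]: "sets Q = sets MU"
      by (auto simp: space_prob_algebra)
    have space_Q: "space Q = space MU"
      using sets_Q by (rule sets_eq_imp_space_eq)
    \<comment> \<open>A probability measure lives on a nonempty space, so a reference point exists;
      by \<open>prior\<close> the choice does not affect the image measure \<open>\<nu>\<close>
      defined from it.\<close>
    obtain u0 where u0: "u0 \<in> space MU"
      using prob_space.not_empty[OF Q] space_Q by auto
    have sol_inverse: "fiducial_solution M\<Theta> \<tau> (\<tau> (u, x)) u = x"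
      if "u \<in> space MU" "x \<in> space M\<Theta>" for u x
      using that measurable_space[OF \<tau>, of "(u, x)"]
      by (intro simple_model_fiducial_solution[OF simple]) (auto simp: space_pair_measure)
    define \<nu> where "\<nu> = distr P MT (\<lambda>x. \<tau> (u0, x))"
    have sets_\<nu> [measurable_cong]: "sets \<nu> = sets MT"
      by (simp add: \<nu>_def)
    have P: "sigma_finite_measure P"
      using \<Theta> by (simp add: P_def sigma_finite_element_def)
    have \<nu>: "sigma_finite_measure \<nu>"
      unfolding \<nu>_def
    \<comment> \<open>The left inverse is the solution map of the fiducial equation at
      \<open>u0\<close>, measurable as a section of the map in
      \<open>solution_measurable\<close>.\<close>
    proof (rule sigma_finite_measure_distr_left_inverse[OF P])
      show "(\<lambda>x. \<tau> (u0, x)) \<in> P \<rightarrow>\<^sub>M MT"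
        using u0 by measurable
      show "(\<lambda>t. fiducial_solution M\<Theta> \<tau> t u0) \<in> MT \<rightarrow>\<^sub>M P"
        using measurable_compose[OF measurable_Pair1'[OF u0] solution_measurable]
        by (simp add: measurable_cong_sets[OF refl sets_P])
    qed (simp add: sol_inverse u0 space_P)
    have fibre: "distr P \<nu> (\<lambda>x. \<tau> (u, x)) = \<nu>" if "u \<in> space Q" for u
      using prior[OF _ u0, of u] that
      by (simp add: \<nu>_def P_def[symmetric] space_Q cong: distr_cong)
    have joint_\<Theta>: "distr M (MU \<Otimes>\<^sub>M M\<Theta>) (\<lambda>\<omega>. (U \<omega>, \<Theta> \<omega>)) = Q \<Otimes>\<^sub>M P"
      unfolding P_def
      by (rule conditional_law_const_pair[OF Q sets_Q law_U]) (simp add: Q_def PU_const[OF _ \<theta>])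
    have "Q \<Otimes>\<^sub>M \<nu> = distr (Q \<Otimes>\<^sub>M P) (Q \<Otimes>\<^sub>M \<nu>) (\<lambda>(u, x). (u, \<tau> (u, x)))"
      by (rule distr_pair_fibrewise[symmetric, OF Q P \<nu> _ fibre]) auto
    also have "\<dots> = distr M (Q \<Otimes>\<^sub>M \<nu>) (\<lambda>\<omega>. (U \<omega>, T \<omega>))"
      unfolding joint_\<Theta>[symmetric]
      by (subst distr_distr) (auto simp: T_def comp_def)
    finally have joint_\<nu>: "Q \<Otimes>\<^sub>M \<nu> = distr M (Q \<Otimes>\<^sub>M \<nu>) (\<lambda>\<omega>. (U \<omega>, T \<omega>))" .
    interpret Q: prob_space Q by (rule Q)
    interpret \<nu>: sigma_finite_measure \<nu> by (rule \<nu>)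
    \<comment> \<open>The law of \<open>T\<close> is the second marginal of the product. Since
      \<open>Q\<close> has total mass 1, the strip \<open>space Q \<times> A\<close> has measure
      exactly \<open>\<nu> A\<close>, even if \<open>\<nu>\<close> is infinite.\<close>
    have law_T: "distr M MT T = \<nu>"
    proof -
      have "\<nu> = distr (Q \<Otimes>\<^sub>M \<nu>) \<nu> snd"
      proof (rule measure_eqI)
        fix A assume A: "A \<in> sets \<nu>"
        then have "snd -` A \<inter> space (Q \<Otimes>\<^sub>M \<nu>) = space Q \<times> A"
          by (auto simp: space_pair_measure dest: sets.sets_into_space)
        then show "emeasure \<nu> A = emeasure (distr (Q \<Otimes>\<^sub>M \<nu>) \<nu> snd) A"
          using A by (simp add: emeasure_distr \<nu>.emeasure_pair_measure_Times Q.emeasure_space_1)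
      qed simp
      also have "\<dots> = distr M \<nu> T"
        using T_meas U by (subst joint_\<nu>) (subst distr_distr; simp add: comp_def)
      finally show ?thesis
        using sets_\<nu> by (simp cong: distr_cong)
    qed
    have T: "sigma_finite_element M MT T"
      using T_meas \<nu> by (simp add: sigma_finite_element_def law_T)
    have "conditional_law M M\<Theta> \<Theta> MT T (\<lambda>t. distr Q M\<Theta> (fiducial_solution M\<Theta> \<tau> t))"
    \<comment> \<open>Now \<open>T\<close> is the conditioning element and \<open>U\<close> the
      noise in product form with it. The last goal recovers \<open>\<Theta>\<close> pointwise from
      both by solving the fiducial equation.\<close>
    proof (rule conditional_law_of_independent[OF Q T])
      show "U \<in> M \<rightarrow>\<^sub>M Q"
        by measurable
      show "distr M (Q \<Otimes>\<^sub>M MT) (\<lambda>\<omega>. (U \<omega>, T \<omega>)) = Q \<Otimes>\<^sub>M distr M MT T"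
        unfolding law_T
        by (subst joint_\<nu>) (intro distr_cong sets_pair_measure_cong refl sets_\<nu>[symmetric])
      show "(\<lambda>(u, t). fiducial_solution M\<Theta> \<tau> t u) \<in> Q \<Otimes>\<^sub>M MT \<rightarrow>\<^sub>M M\<Theta>"
        using solution_measurable
        by (simp add: measurable_cong_sets[OF sets_pair_measure_cong[OF sets_Q refl] refl])
      show "\<Theta> \<omega> = fiducial_solution M\<Theta> \<tau> (T \<omega>) (U \<omega>)" if "\<omega> \<in> space M" for \<omega>
        using that by (simp add: T_def sol_inverse measurable_space[OF U] measurable_space[OF \<Theta>_meas])
    qed
    with T show ?thesis
      by (simp add: fiducial_distribution_def[abs_def] Q_def)
  qed
  have "sigma_finite_element M MT T"
  \<comment> \<open>With an empty parameter space \<open>main\<close> has no instance. Then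
    \<open>space M\<close> is empty too, and the law of \<open>T\<close> is the zero
    measure.\<close>
  proof (cases "space M\<Theta> = {}")
    case True
    then have "space M = {}"
      using measurable_space[OF \<Theta>_meas] by auto
    then have "finite_measure (distr M MT T)"
      by (intro finite_measureI) (simp add: emeasure_distr T_meas)
    then show ?thesis
      using T_meas by (simp add: sigma_finite_element_def finite_measure.sigma_finite_measure)
  next
    case False
    then show ?thesis
      using main by auto
  qed
  then show ?thesis
    using main conditional_law_AE_unique by blast
qed

end
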